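(* Let $N\ge 1$ and let $\mathcal{A}$ be the algebra with generators $x_1,\dots,x_N,p_1,\dots,p_N$ defined in the context. Put $L_{ij}=x_ip_j-x_jp_i$ and $C_{ij}=[p_i,x_j]=p_ix_j-x_jp_i$. Then for all $i,j,k,l\in\{1,\dots,N\}$ the following relations hold in $\mathcal{A}$: $$[L_{ij},L_{kl}]=L_{il}C_{jk}+L_{jk}C_{il}+L_{ki}C_{lj}+L_{lj}C_{ki}=C_{jk}L_{il}+C_{il}L_{jk}+C_{lj}L_{ki}+C_{ki}L_{lj},$$ $$\{L_{ij},L_{kl}\}+\{L_{ki},L_{jl}\}+\{L_{jk},L_{il}\}=0,$$ $$[L_{ij},C_{kl}]+[L_{ki},C_{jl}]+[L_{jk},C_{il}]=0,$$ and $$L_{ij}L_{kl}+L_{ki}L_{jl}+L_{jk}L_{il}=L_{ij}C_{kl}+L_{ki}C_{jl}+L_{jk}C_{il}.$$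
   Context: Let $\mathbb{K}$ be $\mathbb{R}$ or $\mathbb{C}$. $\mathcal{A}$ is the unital associative $\mathbb{K}$-algebra generated by $x_1,\dots,x_N,p_1,\dots,p_N$ subject to the relations, for all $i,j$, $$[x_i,x_j]=0,\quad [p_i,p_j]=0,\quad \Big[\tfrac12\sum_{i=1}^N p_i^2,\,x_j\Big]=p_j,\quad \Big[\tfrac12\sum_{i=1}^N x_i^2,\,p_j\Big]=-x_j,$$ where $[a,b]=ab-ba$ and $\{a,b\}=ab+ba$. *)

theory Defs
  imports Complex_Main "HOL-Library.Poly_Mapping"
begin

section \<open>The free associative algebra\<close>

text \<open>
  Words form the free monoid. It is written additively because the multiplication of
  \<^typ>\<open>'a \<Rightarrow>\<^sub>0 'b\<close> is convolution with respect to the addition of \<^typ>\<open>'a\<close>. Hence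
  \<open>'g word \<Rightarrow>\<^sub>0 'k\<close> is the free unital associative algebra of noncommutative
  polynomials over \<open>'k\<close> in the letters \<open>'g\<close>.
\<close>

datatype 'g word = Word (letters: "'g list")

instantiation word :: (type) monoid_add
begin

definition "0 = Word []"
definition "u + v = Word (letters u @ letters v)"

instance
  by standard (simp_all add: zero_word_def plus_word_def)

end

definition letter :: "'g \<Rightarrow> 'g word \<Rightarrow>\<^sub>0 'k::field"
  where "letter g = Poly_Mapping.single (Word [g]) 1"

definition const :: "'k \<Rightarrow> 'g word \<Rightarrow>\<^sub>0 'k::field"
  where "const c = Poly_Mapping.single 0 c"

lemma free_induct [case_names zero single add]:
  assumes "P 0"
    and single: "\<And>w c. P (Poly_Mapping.single w c)"
    and add: "\<And>f g. P f \<Longrightarrow> P g \<Longrightarrow> P (f + g)"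
  shows "P f"
proof (induction f rule: update_induct)
  case const
  show ?case by fact
next
  case (update f w c)
  have "Poly_Mapping.update w c f = f + Poly_Mapping.single w c"
    using update.hyps
    by (intro poly_mapping_eqI)
      (auto simp: lookup_add lookup_update lookup_single when_def in_keys_iff)
  then show ?case
    using add[OF update.IH single] by simp
qed

lemma const_commute: "const c * f = f * const c"
  by (induction f rule: free_induct)
    (simp_all add: distrib_left distrib_right const_def mult_single mult.commute)

lemma word_plus_eq_0_iff: "u + v = (0 :: 'g word) \<longleftrightarrow> u = 0 \<and> v = 0"
  by (cases u; cases v) (simp add: zero_word_def plus_word_def)

lemma lookup_mult_0:
  fixes f g :: "'g word \<Rightarrow>\<^sub>0 'k::field"
  shows "Poly_Mapping.lookup (f * g) 0 = Poly_Mapping.lookup f 0 * Poly_Mapping.lookup g 0"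
proof (induction f rule: free_induct)
  case (single w c)
  show ?case
    by (induction g rule: free_induct)
      (auto simp: distrib_left lookup_add mult_single lookup_single when_def word_plus_eq_0_iff)
qed (simp_all add: distrib_right lookup_add)

definition commutator :: "'a \<Rightarrow> 'a \<Rightarrow> 'a::ring"  ("\<lbrakk>_, _\<rbrakk>")
  where "\<lbrakk>a, b\<rbrakk> = a * b - b * a"

definition anticommutator :: "'a \<Rightarrow> 'a \<Rightarrow> 'a::ring"  ("\<lbrace>_, _\<rbrace>")
  where "\<lbrace>a, b\<rbrace> = a * b + b * a"

inductive_set two_sided_ideal :: "'a::ring_1 set \<Rightarrow> 'a set" for R where
  zero: "0 \<in> two_sided_ideal R"
| gen: "r \<in> R \<Longrightarrow> a * r * b \<in> two_sided_ideal R"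
| add: "f \<in> two_sided_ideal R \<Longrightarrow> g \<in> two_sided_ideal R \<Longrightarrow> f + g \<in> two_sided_ideal R"

lemma two_sided_ideal_mult_left: "f \<in> two_sided_ideal R \<Longrightarrow> c * f \<in> two_sided_ideal R"
proof (induction rule: two_sided_ideal.induct)
  case (gen r a b)
  then show ?case
    using two_sided_ideal.gen[of r R "c * a" b] by (simp add: mult.assoc)
qed (auto simp: distrib_left intro: two_sided_ideal.intros)

lemma two_sided_ideal_mult_right: "f \<in> two_sided_ideal R \<Longrightarrow> f * c \<in> two_sided_ideal R"
proof (induction rule: two_sided_ideal.induct)
  case (gen r a b)
  then show ?case
    using two_sided_ideal.gen[of r R a "b * c"] by (simp add: mult.assoc)
qed (auto simp: distrib_right intro: two_sided_ideal.intros)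

lemma two_sided_ideal_uminus: "f \<in> two_sided_ideal R \<Longrightarrow> - f \<in> two_sided_ideal R"
  using two_sided_ideal_mult_left[of f R "- 1"] by simp

lemma two_sided_ideal_diff:
  "f \<in> two_sided_ideal R \<Longrightarrow> g \<in> two_sided_ideal R \<Longrightarrow> f - g \<in> two_sided_ideal R"
  using two_sided_ideal.add[of f R "- g"] two_sided_ideal_uminus[of g R] by simp

lemma two_sided_ideal_base: "r \<in> R \<Longrightarrow> r \<in> two_sided_ideal R"
  using two_sided_ideal.gen[of r R 1 1] by simp


section \<open>The algebra generated by the positions and momenta\<close>

text \<open>The finite type \<open>'n\<close> is the index set, so \<open>N = CARD('n) \<ge> 1\<close>.\<close>

datatype 'n generator = Pos 'n | Mom 'n

definition defining_relators :: "('n::finite generator word \<Rightarrow>\<^sub>0 'k::field) set" where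
  "defining_relators =
     (\<Union>i j. {\<lbrakk>letter (Pos i), letter (Pos j)\<rbrakk>,
             \<lbrakk>letter (Mom i), letter (Mom j)\<rbrakk>,
             \<lbrakk>const (1/2) * (\<Sum>m\<in>UNIV. letter (Mom m) ^ 2), letter (Pos j)\<rbrakk> - letter (Mom j),
             \<lbrakk>const (1/2) * (\<Sum>m\<in>UNIV. letter (Pos m) ^ 2), letter (Mom j)\<rbrakk> + letter (Pos j)})"

definition alg_rel :: "('n::finite generator word \<Rightarrow>\<^sub>0 'k::field) \<Rightarrow> ('n generator word \<Rightarrow>\<^sub>0 'k) \<Rightarrow> bool"
  where "alg_rel f g \<longleftrightarrow> f - g \<in> two_sided_ideal defining_relators"

lemma equivp_alg_rel: "equivp alg_rel"
proof (rule equivpI)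
  show "reflp alg_rel"
    by (auto simp: reflp_def alg_rel_def intro: two_sided_ideal.zero)
  show "symp alg_rel"
    by (metis sympI alg_rel_def minus_diff_eq two_sided_ideal_uminus)
  show "transp alg_rel"
  proof (rule transpI)
    fix f g h :: "'n::finite generator word \<Rightarrow>\<^sub>0 'k::field"
    assume "alg_rel f g" "alg_rel g h"
    then have "(f - g) + (g - h) \<in> two_sided_ideal defining_relators"
      unfolding alg_rel_def by (rule two_sided_ideal.add)
    then show "alg_rel f h"
      by (simp add: alg_rel_def)
  qed
qed

quotient_type (overloaded) ('k, 'n) alg = "'n::finite generator word \<Rightarrow>\<^sub>0 'k::field" / alg_rel
  by (rule equivp_alg_rel)

instantiation alg :: (field, finite) ring
begin

lift_definition zero_alg :: "('a, 'b) alg" is 0 .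

lift_definition plus_alg :: "('a, 'b) alg \<Rightarrow> ('a, 'b) alg \<Rightarrow> ('a, 'b) alg" is "(+)"
  unfolding alg_rel_def by (metis add_diff_add two_sided_ideal.add)

lift_definition minus_alg :: "('a, 'b) alg \<Rightarrow> ('a, 'b) alg \<Rightarrow> ('a, 'b) alg" is "(-)"
proof -
  fix f f' g g' :: "'b::finite generator word \<Rightarrow>\<^sub>0 'a::field"
  assume "alg_rel f f'" "alg_rel g g'"
  then have "(f - f') - (g - g') \<in> two_sided_ideal defining_relators"
    unfolding alg_rel_def by (rule two_sided_ideal_diff)
  then show "alg_rel (f - g) (f' - g')"
    by (simp add: alg_rel_def algebra_simps)
qed

lift_definition uminus_alg :: "('a, 'b) alg \<Rightarrow> ('a, 'b) alg" is uminus
  unfolding alg_rel_def by (metis minus_diff_minus two_sided_ideal_uminus)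

lift_definition times_alg :: "('a, 'b) alg \<Rightarrow> ('a, 'b) alg \<Rightarrow> ('a, 'b) alg" is "(*)"
proof -
  fix f f' g g' :: "'b::finite generator word \<Rightarrow>\<^sub>0 'a::field"
  assume "alg_rel f f'" "alg_rel g g'"
  then have "(f - f') * g + f' * (g - g') \<in> two_sided_ideal defining_relators"
    unfolding alg_rel_def
    by (intro two_sided_ideal.add two_sided_ideal_mult_left two_sided_ideal_mult_right)
  then show "alg_rel (f * g) (f' * g')"
    by (simp add: alg_rel_def algebra_simps)
qed

instance
  by standard
    (transfer; simp add: alg_rel_def two_sided_ideal.zero algebra_simps)+

end

lemma lookup_letter_0: "Poly_Mapping.lookup (letter g) 0 = 0"
  by (simp add: letter_def lookup_single zero_word_def)

lemma lookup_relator_0: "r \<in> defining_relators \<Longrightarrow> Poly_Mapping.lookup r 0 = 0"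
  by (auto simp: defining_relators_def commutator_def lookup_minus lookup_add lookup_mult_0
      lookup_letter_0)

lemma one_notin_ideal: "1 \<notin> two_sided_ideal defining_relators"
proof -
  have "Poly_Mapping.lookup f 0 = 0" if "f \<in> two_sided_ideal defining_relators"
    for f :: "'n::finite generator word \<Rightarrow>\<^sub>0 'k::field"
    using that by induction (simp_all add: lookup_mult_0 lookup_add lookup_relator_0)
  then show ?thesis
    by force
qed

instantiation alg :: (field, finite) ring_1
begin

lift_definition one_alg :: "('a, 'b) alg" is 1 .

instance
proof
  show "(0 :: ('a, 'b) alg) \<noteq> 1"
    using one_notin_ideal two_sided_ideal_uminus[of "- 1"]
    by (auto simp: zero_alg_def one_alg_def alg.abs_eq_iff alg_rel_def)
qed (transfer; simp add: alg_rel_def two_sided_ideal.zero)+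

end

lift_definition alg_scale :: "'k \<Rightarrow> ('k::field, 'n::finite) alg \<Rightarrow> ('k, 'n) alg"
  is "\<lambda>c f. const c * f"
  unfolding alg_rel_def by (metis right_diff_distrib two_sided_ideal_mult_left)

lift_definition alg_x :: "'n \<Rightarrow> ('k::field, 'n::finite) alg" is "\<lambda>i. letter (Pos i)" .

lift_definition alg_p :: "'n \<Rightarrow> ('k::field, 'n::finite) alg" is "\<lambda>i. letter (Mom i)" .

lemma alg_scale_vector_space: "vector_space (alg_scale :: 'k::field \<Rightarrow> ('k, 'n::finite) alg \<Rightarrow> _)"
proof
  fix c d :: 'k and a b :: "('k, 'n) alg"
  show "alg_scale c (a + b) = alg_scale c a + alg_scale c b"
    by transfer (simp add: alg_rel_def two_sided_ideal.zero distrib_left)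
  show "alg_scale (c + d) a = alg_scale c a + alg_scale d a"
    by transfer (simp add: alg_rel_def two_sided_ideal.zero const_def single_add distrib_right)
  show "alg_scale c (alg_scale d a) = alg_scale (c * d) a"
    by transfer
      (simp add: alg_rel_def two_sided_ideal.zero const_def mult_single flip: mult.assoc)
  show "alg_scale 1 a = a"
    by transfer (simp add: alg_rel_def two_sided_ideal.zero const_def)
qed

lemma alg_scale_mult_left: "alg_scale c a * b = alg_scale c (a * b)"
  by transfer (simp add: alg_rel_def two_sided_ideal.zero mult.assoc)

lemma alg_scale_mult_right: "a * alg_scale c b = alg_scale c (a * b)"
proof transfer
  fix a b :: "'n::finite generator word \<Rightarrow>\<^sub>0 'k::field" and c
  have "a * (const c * b) = const c * (a * b)"
    by (metis const_commute mult.assoc)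
  then show "alg_rel (a * (const c * b)) (const c * (a * b))"
    by (simp add: alg_rel_def two_sided_ideal.zero)
qed

lemma abs_alg_const_mult: "abs_alg (const c) * a = alg_scale c a"
  by transfer (simp add: alg_rel_def two_sided_ideal.zero)

lemma abs_alg_sum: "abs_alg (\<Sum>m\<in>A. f m) = (\<Sum>m\<in>A. abs_alg (f m))"
  by (induction A rule: infinite_finite_induct)
    (simp_all add: plus_alg.abs_eq[symmetric] zero_alg.abs_eq)

lemma alg_relator:
  assumes "r \<in> defining_relators"
  shows "abs_alg r = 0"
  using assms
  by (simp add: zero_alg.abs_eq alg.abs_eq_iff alg_rel_def two_sided_ideal_base)

lemma alg_defining_relations:
  fixes i j :: "'n::finite"
  defines "x \<equiv> alg_x :: 'n \<Rightarrow> ('k::field, 'n) alg" and "p \<equiv> alg_p :: 'n \<Rightarrow> ('k, 'n) alg"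
  shows "\<lbrakk>x i, x j\<rbrakk> = 0"
    and "\<lbrakk>p i, p j\<rbrakk> = 0"
    and "\<lbrakk>alg_scale (1/2) (\<Sum>m\<in>UNIV. p m ^ 2), x j\<rbrakk> = p j"
    and "\<lbrakk>alg_scale (1/2) (\<Sum>m\<in>UNIV. x m ^ 2), p j\<rbrakk> = - x j"
proof -
  note abs = commutator_def power2_eq_square abs_alg_sum
    minus_alg.abs_eq[symmetric] plus_alg.abs_eq[symmetric] times_alg.abs_eq[symmetric]
    abs_alg_const_mult alg_x.abs_eq[symmetric] alg_p.abs_eq[symmetric]
  have "abs_alg \<lbrakk>letter (Pos i), letter (Pos j) :: _ \<Rightarrow>\<^sub>0 'k\<rbrakk> = 0"
    by (rule alg_relator) (auto simp: defining_relators_def)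
  then show "\<lbrakk>x i, x j\<rbrakk> = 0"
    by (simp add: abs x_def)
  have "abs_alg \<lbrakk>letter (Mom i), letter (Mom j) :: _ \<Rightarrow>\<^sub>0 'k\<rbrakk> = 0"
    by (rule alg_relator) (auto simp: defining_relators_def)
  then show "\<lbrakk>p i, p j\<rbrakk> = 0"
    by (simp add: abs p_def)
  have "abs_alg (\<lbrakk>const (1/2) * (\<Sum>m\<in>UNIV. letter (Mom m) ^ 2), letter (Pos j)\<rbrakk>
      - (letter (Mom j) :: _ \<Rightarrow>\<^sub>0 'k)) = 0"
    by (rule alg_relator) (auto simp: defining_relators_def)
  then show "\<lbrakk>alg_scale (1/2) (\<Sum>m\<in>UNIV. p m ^ 2), x j\<rbrakk> = p j"
    by (simp add: abs x_def p_def)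
  have "abs_alg (\<lbrakk>const (1/2) * (\<Sum>m\<in>UNIV. letter (Pos m) ^ 2), letter (Mom j)\<rbrakk>
      + (letter (Pos j) :: _ \<Rightarrow>\<^sub>0 'k)) = 0"
    by (rule alg_relator) (auto simp: defining_relators_def)
  then show "\<lbrakk>alg_scale (1/2) (\<Sum>m\<in>UNIV. x m ^ 2), p j\<rbrakk> = - x j"
    by (simp add: abs x_def p_def eq_neg_iff_add_eq_0)
qed

definition alg_L :: "'n \<Rightarrow> 'n \<Rightarrow> ('k::field, 'n::finite) alg"
  where "alg_L i j = alg_x i * alg_p j - alg_x j * alg_p i"

definition alg_C :: "'n \<Rightarrow> 'n \<Rightarrow> ('k::field, 'n::finite) alg"
  where "alg_C i j = \<lbrakk>alg_p i, alg_x j\<rbrakk>"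

end

theory Submission
  imports Defs
begin

text \<open>
  Apart from \<open>[x\<^sub>i, x\<^sub>j] = [p\<^sub>i, p\<^sub>j] = 0\<close>, only the symmetry \<open>C\<^sub>i\<^sub>j = C\<^sub>j\<^sub>i\<close> matters; it comes from
  applying the derivation \<open>[\<Sum>p\<^sup>2/2, \<cdot>]\<close> to \<open>[x\<^sub>i, x\<^sub>j] = 0\<close>. By the Jacobi identity, \<open>[x\<^sub>i, C\<^sub>j\<^sub>k]\<close> and
  \<open>[p\<^sub>i, C\<^sub>j\<^sub>k]\<close> are then totally symmetric, so they cancel in the sums of \<open>[L, C]\<close> that occur, which
  gives the relations between the products \<open>L C\<close> and \<open>C L\<close>. For the quadratic relations,
  \<open>L\<^sub>i\<^sub>j = x\<^sub>i p\<^sub>j - x\<^sub>j p\<^sub>i = p\<^sub>j x\<^sub>i - p\<^sub>i x\<^sub>j\<close> makes the cyclic sums of \<open>L\<^sub>i\<^sub>j x\<^sub>k\<close>, \<open>L\<^sub>i\<^sub>j p\<^sub>k\<close>, \<open>x\<^sub>k L\<^sub>i\<^sub>j\<close> and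
  \<open>p\<^sub>k L\<^sub>i\<^sub>j\<close> vanish.
\<close>

lemma commutator_mult_left: "\<lbrakk>a * b, c\<rbrakk> = a * \<lbrakk>b, c\<rbrakk> + \<lbrakk>a, c\<rbrakk> * b"
  by (simp add: commutator_def algebra_simps)

lemma commutator_mult_right: "\<lbrakk>a, b * c\<rbrakk> = b * \<lbrakk>a, c\<rbrakk> + \<lbrakk>a, b\<rbrakk> * c"
  by (simp add: commutator_def algebra_simps)

lemma commutator_diff_left: "\<lbrakk>a - b, c\<rbrakk> = \<lbrakk>a, c\<rbrakk> - \<lbrakk>b, c\<rbrakk>"
  by (simp add: commutator_def algebra_simps)

lemma commutator_diff_right: "\<lbrakk>a, b - c\<rbrakk> = \<lbrakk>a, b\<rbrakk> - \<lbrakk>a, c\<rbrakk>"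
  by (simp add: commutator_def algebra_simps)

lemma commutator_zero_right [simp]: "\<lbrakk>a, 0\<rbrakk> = 0"
  by (simp add: commutator_def)

lemma commutator_commutator: "\<lbrakk>a, \<lbrakk>b, c\<rbrakk>\<rbrakk> = \<lbrakk>\<lbrakk>a, b\<rbrakk>, c\<rbrakk> + \<lbrakk>b, \<lbrakk>a, c\<rbrakk>\<rbrakk>"
  by (simp add: commutator_def algebra_simps)

text \<open>Working in an arbitrary ring serves both scalar fields at once and keeps the quotient
  construction out of the computations.\<close>

locale symmetric_pair =
  fixes x p :: "'n \<Rightarrow> 'a::ring"
  assumes x_commute: "x i * x j = x j * x i"
    and p_commute: "p i * p j = p j * p i"
    and commutator_sym: "\<lbrakk>p i, x j\<rbrakk> = \<lbrakk>p j, x i\<rbrakk>"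
begin

definition C :: "'n \<Rightarrow> 'n \<Rightarrow> 'a"
  where "C i j = \<lbrakk>p i, x j\<rbrakk>"

definition L :: "'n \<Rightarrow> 'n \<Rightarrow> 'a"
  where "L i j = x i * p j - x j * p i"

lemma C_sym: "C i j = C j i"
  unfolding C_def by (rule commutator_sym)

lemma p_mult_x: "p i * x j = x j * p i + C i j"
  by (simp add: C_def commutator_def)

text \<open>Moving both momenta to the left adds \<open>C i j - C j i\<close>, which vanishes by
  symmetry.\<close>

lemma L_altdef: "L i j = p j * x i - p i * x j"
  by (simp add: L_def p_mult_x C_sym[of j i])

lemma x_C_swap: "\<lbrakk>x i, C j k\<rbrakk> = \<lbrakk>x j, C i k\<rbrakk>"
proof -
  \<comment> \<open>Jacobi identity, with \<open>C j k\<close> and \<open>C i k\<close> read as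
    brackets of \<open>p k\<close> so that the leftover bracket involves only positions.\<close>
  have "\<lbrakk>x i, \<lbrakk>p k, x j\<rbrakk>\<rbrakk> = \<lbrakk>x j, \<lbrakk>p k, x i\<rbrakk>\<rbrakk> - \<lbrakk>p k, \<lbrakk>x j, x i\<rbrakk>\<rbrakk>"
    by (simp add: commutator_def algebra_simps)
  also have "\<lbrakk>x j, x i\<rbrakk> = 0"
    by (simp add: commutator_def x_commute[of j i])
  finally show ?thesis
    by (simp add: C_def commutator_sym[of _ k])
qed

lemma p_C_swap: "\<lbrakk>p i, C j k\<rbrakk> = \<lbrakk>p j, C i k\<rbrakk>"
proof -
  have "\<lbrakk>p i, \<lbrakk>p j, x k\<rbrakk>\<rbrakk> = \<lbrakk>p j, \<lbrakk>p i, x k\<rbrakk>\<rbrakk> + \<lbrakk>\<lbrakk>p i, p j\<rbrakk>, x k\<rbrakk>"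
    by (simp add: commutator_def algebra_simps)
  moreover have "\<lbrakk>p i, p j\<rbrakk> = 0"
    by (simp add: commutator_def p_commute[of i j])
  ultimately show ?thesis
    by (simp add: C_def commutator_def)
qed

lemma L_C_commutator:
  "\<lbrakk>L i j, C k l\<rbrakk> = x i * \<lbrakk>p j, C k l\<rbrakk> + \<lbrakk>x i, C k l\<rbrakk> * p j - x j * \<lbrakk>p i, C k l\<rbrakk> - \<lbrakk>x j, C k l\<rbrakk> * p i"
  by (simp add: L_def commutator_diff_left commutator_mult_left)

lemma L_C_cyclic: "\<lbrakk>L i j, C k l\<rbrakk> + \<lbrakk>L k i, C j l\<rbrakk> + \<lbrakk>L j k, C i l\<rbrakk> = 0"
  \<comment> \<open>These instances move the earlier of the two indices among \<open>i\<close>,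
    \<open>j\<close>, \<open>k\<close> outside \<open>C\<close>; the twelve terms then cancel in
    pairs.\<close>
  unfolding L_C_commutator x_C_swap[of k i l] x_C_swap[of j i l] x_C_swap[of k j l]
    p_C_swap[of k i l] p_C_swap[of j i l] p_C_swap[of k j l]
  by simp

text \<open>Of the two forms of \<open>L\<close>, the one placing its positions next to the extra
  position is used: these commute, so the six terms cancel in pairs. The next three lemmas choose
  the form in the same way.\<close>

lemma L_x_cyclic: "L i j * x k + L k i * x j + L j k * x i = 0"
  by (simp add: L_altdef left_diff_distrib mult.assoc
      x_commute[of k i] x_commute[of j i] x_commute[of k j])

lemma L_p_cyclic: "L i j * p k + L k i * p j + L j k * p i = 0"
  by (simp add: L_def left_diff_distrib mult.assoc
      p_commute[of k i] p_commute[of j i] p_commute[of k j])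

lemma x_L_cyclic: "x k * L i j + x j * L k i + x i * L j k = 0"
  by (simp add: L_def right_diff_distrib flip: mult.assoc)
    (simp add: x_commute[of k i] x_commute[of j i] x_commute[of k j])

lemma p_L_cyclic: "p k * L i j + p j * L k i + p i * L j k = 0"
  by (simp add: L_altdef right_diff_distrib flip: mult.assoc)
    (simp add: p_commute[of k i] p_commute[of j i] p_commute[of k j])

lemma L_L_cyclic:
  "L i j * L k l + L k i * L j l + L j k * L i l = L i j * C k l + L k i * C j l + L j k * C i l"
proof -
  \<comment> \<open>With index \<open>l\<close> rightmost in the first two terms, \<open>p l\<close>
    and \<open>x l\<close> factor out of the sum and leave vanishing cyclic sums.\<close>
  have L: "L a l = x a * p l - p a * x l + C a l" for a
    by (simp add: L_def p_mult_x)
  have "L i j * L k l + L k i * L j l + L j k * L i l =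
      (L i j * x k + L k i * x j + L j k * x i) * p l
      - (L i j * p k + L k i * p j + L j k * p i) * x l
      + (L i j * C k l + L k i * C j l + L j k * C i l)"
    by (simp add: L[of i] L[of j] L[of k] algebra_simps)
  then show ?thesis
    by (simp add: L_x_cyclic L_p_cyclic)
qed

lemma L_L_cyclic':
  "L k l * L i j + L j l * L k i + L i l * L j k = - (C k l * L i j + C j l * L k i + C i l * L j k)"
proof -
  \<comment> \<open>Mirror image: index \<open>l\<close> is now leftmost, and the correction
    \<open>C a l\<close> changes sign.\<close>
  have L: "L a l = p l * x a - x l * p a - C a l" for a
    by (simp add: L_altdef p_mult_x)
  have "L k l * L i j + L j l * L k i + L i l * L j k =
      p l * (x k * L i j + x j * L k i + x i * L j k)
      - x l * (p k * L i j + p j * L k i + p i * L j k)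
      - (C k l * L i j + C j l * L k i + C i l * L j k)"
    by (simp add: L[of i] L[of j] L[of k] algebra_simps)
  then show ?thesis
    by (simp add: x_L_cyclic p_L_cyclic)
qed

text \<open>The corrections of the two orderings have opposite signs, so their sum is the cyclic sum
  of commutators of \<open>L\<close> with \<open>C\<close>.\<close>

lemma L_L_anticommutator_cyclic:
  "\<lbrace>L i j, L k l\<rbrace> + \<lbrace>L k i, L j l\<rbrace> + \<lbrace>L j k, L i l\<rbrace> = 0"
proof -
  have "\<lbrace>L i j, L k l\<rbrace> + \<lbrace>L k i, L j l\<rbrace> + \<lbrace>L j k, L i l\<rbrace> =
      (L i j * L k l + L k i * L j l + L j k * L i l)
      + (L k l * L i j + L j l * L k i + L i l * L j k)"
    by (simp add: anticommutator_def algebra_simps)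
  also have "\<dots> = \<lbrakk>L i j, C k l\<rbrakk> + \<lbrakk>L k i, C j l\<rbrakk> + \<lbrakk>L j k, C i l\<rbrakk>"
    unfolding L_L_cyclic L_L_cyclic' by (simp add: commutator_def)
  finally show ?thesis
    by (simp add: L_C_cyclic)
qed

lemma L_x_commutator: "\<lbrakk>L i j, x k\<rbrakk> = x i * C j k - x j * C i k"
proof -
  have "\<lbrakk>x a, x k\<rbrakk> = 0" for a
    by (simp add: commutator_def x_commute[of a k])
  then show ?thesis
    by (simp add: L_def commutator_diff_left commutator_mult_left C_def)
qed

lemma L_p_commutator: "\<lbrakk>L i j, p k\<rbrakk> = C k j * p i - C k i * p j"
proof -
  have "\<lbrakk>p a, p k\<rbrakk> = 0" "\<lbrakk>x a, p k\<rbrakk> = - C k a" for a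
    by (simp_all add: commutator_def C_def p_commute[of a k])
  then show ?thesis
    by (simp add: L_def commutator_diff_left commutator_mult_left)
qed

lemma L_C_sum_commute:
  "L i l * C j k + L j k * C i l + L k i * C l j + L l j * C k i =
   C j k * L i l + C i l * L j k + C l j * L k i + C k i * L l j"
proof -
  \<comment> \<open>In the expanded sum these cancel the terms with left factor \<open>x i\<close>,
    \<open>x l\<close>, \<open>x j\<close>, \<open>x k\<close> in turn; \<open>x_eqs\<close> does
    the same for the right factors \<open>p i\<close>, \<open>p l\<close>, \<open>p j\<close>,
    \<open>p k\<close>.\<close>
  have p_eqs: "\<lbrakk>p l, C j k\<rbrakk> = \<lbrakk>p k, C l j\<rbrakk>" "\<lbrakk>p i, C j k\<rbrakk> = \<lbrakk>p j, C k i\<rbrakk>"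
    "\<lbrakk>p k, C i l\<rbrakk> = \<lbrakk>p l, C k i\<rbrakk>" "\<lbrakk>p j, C i l\<rbrakk> = \<lbrakk>p i, C l j\<rbrakk>"
    by (metis p_C_swap C_sym)+
  have x_eqs: "\<lbrakk>x l, C j k\<rbrakk> = \<lbrakk>x k, C l j\<rbrakk>" "\<lbrakk>x i, C j k\<rbrakk> = \<lbrakk>x j, C k i\<rbrakk>"
    "\<lbrakk>x k, C i l\<rbrakk> = \<lbrakk>x l, C k i\<rbrakk>" "\<lbrakk>x j, C i l\<rbrakk> = \<lbrakk>x i, C l j\<rbrakk>"
    by (metis x_C_swap C_sym)+
  have "\<lbrakk>L i l, C j k\<rbrakk> + \<lbrakk>L j k, C i l\<rbrakk> + \<lbrakk>L k i, C l j\<rbrakk> + \<lbrakk>L l j, C k i\<rbrakk> = 0"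
    by (simp add: L_C_commutator p_eqs x_eqs)
  then show ?thesis
    by (simp add: commutator_def algebra_simps)
qed

lemma L_L_commutator:
  "\<lbrakk>L i j, L k l\<rbrakk> = L i l * C j k + L j k * C i l + L k i * C l j + L l j * C k i"
proof -
  \<comment> \<open>The Leibniz rule leaves \<open>C\<close> between a position and a momentum.
    Pushing it to the right recovers \<open>L\<close> at the cost of brackets of \<open>p\<close>
    with \<open>C\<close>, which cancel across the four groups.\<close>
  have move: "x a * C b c * p d - x d * C b c * p a =
      L a d * C b c - (x a * \<lbrakk>p d, C b c\<rbrakk> - x d * \<lbrakk>p a, C b c\<rbrakk>)" for a b c d
    by (simp add: L_def commutator_def algebra_simps)
  have "\<lbrakk>L i j, L k l\<rbrakk> =
      (x i * C j k * p l - x l * C j k * p i) + (x j * C i l * p k - x k * C i l * p j)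
      + (x k * C l j * p i - x i * C l j * p k) + (x l * C k i * p j - x j * C k i * p l)"
    by (simp add: L_def[of k l] commutator_diff_right commutator_mult_right
        L_x_commutator L_p_commutator C_sym[of l i] C_sym[of k j] C_sym[of j l] C_sym[of i k]
        algebra_simps)
  moreover have "\<lbrakk>p l, C j k\<rbrakk> = \<lbrakk>p k, C l j\<rbrakk>" "\<lbrakk>p i, C j k\<rbrakk> = \<lbrakk>p j, C k i\<rbrakk>"
    "\<lbrakk>p k, C i l\<rbrakk> = \<lbrakk>p l, C k i\<rbrakk>" "\<lbrakk>p j, C i l\<rbrakk> = \<lbrakk>p i, C l j\<rbrakk>"
    by (metis p_C_swap C_sym)+
  ultimately show ?thesis
    by (simp add: move)
qed

end

lemma symmetric_pair_alg:
  "symmetric_pair (alg_x :: 'n \<Rightarrow> ('k::field, 'n::finite) alg) alg_p"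
proof
  fix i j :: 'n
  let ?x = "alg_x :: 'n \<Rightarrow> ('k, 'n) alg" and ?p = "alg_p :: 'n \<Rightarrow> ('k, 'n) alg"
  let ?H = "alg_scale (1/2) (\<Sum>m\<in>UNIV. ?p m ^ 2)"
  show "?x i * ?x j = ?x j * ?x i" "?p i * ?p j = ?p j * ?p i"
    using alg_defining_relations(1,2)[of i j, where 'k = 'k] by (simp_all add: commutator_def)
  \<comment> \<open>Bracketing with \<open>?H\<close> turns \<open>?x i\<close> into
    \<open>?p i\<close>.\<close>
  have "\<lbrakk>?p i, ?x j\<rbrakk> + \<lbrakk>?x i, ?p j\<rbrakk> = \<lbrakk>?H, \<lbrakk>?x i, ?x j\<rbrakk>\<rbrakk>"
    by (simp only: commutator_commutator alg_defining_relations(3))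
  then show "\<lbrakk>?p i, ?x j\<rbrakk> = \<lbrakk>?p j, ?x i\<rbrakk>"
    by (simp add: alg_defining_relations(1)) (simp add: commutator_def algebra_simps)
qed

interpretation alg: symmetric_pair "alg_x :: 'n \<Rightarrow> ('k::field, 'n::finite) alg" alg_p
  rewrites "symmetric_pair.L alg_x alg_p = (alg_L :: 'n \<Rightarrow> 'n \<Rightarrow> ('k, 'n) alg)"
    and "symmetric_pair.C alg_x alg_p = (alg_C :: 'n \<Rightarrow> 'n \<Rightarrow> ('k, 'n) alg)"
proof -
  interpret symmetric_pair "alg_x :: 'n \<Rightarrow> ('k, 'n) alg" alg_p
    by (rule symmetric_pair_alg)
  show "symmetric_pair (alg_x :: 'n \<Rightarrow> ('k, 'n) alg) alg_p"
    by (rule symmetric_pair_alg)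
  show "L = alg_L" "C = alg_C"
    by (simp_all add: fun_eq_iff L_def alg_L_def C_def alg_C_def)
qed

theorem theorem2p5:
  shows "(let L = (alg_L :: 'n::finite \<Rightarrow> 'n \<Rightarrow> (real, 'n) alg);
              C = (alg_C :: 'n \<Rightarrow> 'n \<Rightarrow> (real, 'n) alg)
          in \<forall>i j k l.
               (\<lbrakk>L i j, L k l\<rbrakk> = L i l * C j k + L j k * C i l + L k i * C l j + L l j * C k i \<and>
                L i l * C j k + L j k * C i l + L k i * C l j + L l j * C k i =
                C j k * L i l + C i l * L j k + C l j * L k i + C k i * L l j) \<and>
               \<lbrace>L i j, L k l\<rbrace> + \<lbrace>L k i, L j l\<rbrace> + \<lbrace>L j k, L i l\<rbrace> = 0 \<and>
               \<lbrakk>L i j, C k l\<rbrakk> + \<lbrakk>L k i, C j l\<rbrakk> + \<lbrakk>L j k, C i l\<rbrakk> = 0 \<and>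
               L i j * L k l + L k i * L j l + L j k * L i l =
               L i j * C k l + L k i * C j l + L j k * C i l)
       \<and> (let L = (alg_L :: 'n \<Rightarrow> 'n \<Rightarrow> (complex, 'n) alg);
              C = (alg_C :: 'n \<Rightarrow> 'n \<Rightarrow> (complex, 'n) alg)
          in \<forall>i j k l.
               (\<lbrakk>L i j, L k l\<rbrakk> = L i l * C j k + L j k * C i l + L k i * C l j + L l j * C k i \<and>
                L i l * C j k + L j k * C i l + L k i * C l j + L l j * C k i =
                C j k * L i l + C i l * L j k + C l j * L k i + C k i * L l j) \<and>
               \<lbrace>L i j, L k l\<rbrace> + \<lbrace>L k i, L j l\<rbrace> + \<lbrace>L j k, L i l\<rbrace> = 0 \<and>
               \<lbrakk>L i j, C k l\<rbrakk> + \<lbrakk>L k i, C j l\<rbrakk> + \<lbrakk>L j k, C i l\<rbrakk> = 0 \<and>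
               L i j * L k l + L k i * L j l + L j k * L i l =
               L i j * C k l + L k i * C j l + L j k * C i l)"
  unfolding Let_def
  by (intro conjI allI alg.L_L_commutator alg.L_C_sum_commute alg.L_L_anticommutator_cyclic
      alg.L_C_cyclic alg.L_L_cyclic)

end
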